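(* Let $(T_i)_{i=1}^{\infty}$ be an almost-commuting, submultiplicative sequence of bounded linear operators on a Banach space $X$. Then $(T_i)_{i=1}^\infty$ is mean Li-Yorke chaotic if and only if it satisfies the mean Li-Yorke chaos criterion.
   Context: A sequence $(T_i)_{i=1}^\infty$ of bounded linear operators on a Banach space $X$ (i.e. from $X$ to $X$) is \emph{submultiplicative} if there exists a constant $C>0$ such that $\Vert T_{i+m}z\Vert\le C\Vert T_iT_mz\Vert$ for all $z\in X$ and $i,m\in\mathbb{N}=\{1,2,\dots\}$. It is \emph{almost-commuting} if $\lim_{i\to\infty}(T_iT_k-T_kT_i)x=0$ for all $x\in X$ and $k\in\mathbb{N}$. A pair $(x,y)\in X\times X$ is a \emph{mean Li-Yorke pair} if $\liminf_{n\to\infty}\frac1n\sum_{i=1}^n\Vert T_ix-T_iy\Vert=0$ and $\limsup_{n\to\infty}\frac1n\sum_{i=1}^n\Vert T_ix-T_iy\Vert>0$. A subset of $X$ is \emph{mean Li-Yorke scrambled} if any two distinct points of it form a mean Li-Yorke pair; $(T_i)_i$ is \emph{mean Li-Yorke chaotic} if there exists an uncountable mean Li-Yorke scrambled subset of $X$. $(T_i)_{i=1}^\infty$ satisfies the \emph{mean Li-Yorke chaos criterion} if there exists a subset $X_0$ of $X$ such that: (i) for every $x\in X_0$, $\liminf_{n\to\infty}\frac1n\sum_{i=1}^n\Vert T_ix\Vert=0$; (ii) there exist a sequence $(y_k)_{k\ge1}$ of nonzero vectors in $\overline{\mathrm{span}(X_0)}$ and a sequence $(N_k)_{k\ge1}$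 in $\mathbb{N}$ such that $\frac{1}{N_k}\sum_{i=1}^{N_k}\Vert T_iy_k\Vert\ge k\Vert y_k\Vert$ for every $k\in\mathbb{N}$. *)

theory Defs
  imports "HOL-Analysis.Analysis"
begin

text \<open>
  A Banach space over \<open>\<real>\<close> or \<open>\<complex>\<close>. The library class \<open>banach\<close> only provides real scalars, so
  the scalar multiplication over the ground field is an explicit parameter that extends the real
  one. By the Gelfand--Mazur theorem, the instances of \<open>real_normed_field\<close> are, up to isomorphism,
  exactly \<open>\<real>\<close> and \<open>\<complex>\<close>.
\<close>

locale banach_space = vector_space scl
  for scl :: "'k::real_normed_field \<Rightarrow> 'a::banach \<Rightarrow> 'a" +
  assumes norm_scl: "norm (scl c x) = norm c * norm x"
    and scl_of_real: "scl (of_real r) x = r *\<^sub>R x"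

lemma banach_space_scaleR: "banach_space (scaleR :: real \<Rightarrow> 'a::banach \<Rightarrow> 'a)"
  by unfold_locales (simp_all add: scaleR_right_distrib scaleR_left_distrib)

lemma banach_space_complex: "banach_space ((*) :: complex \<Rightarrow> complex \<Rightarrow> complex)"
  by unfold_locales (auto simp: algebra_simps norm_mult scaleR_conv_of_real)

definition bounded_operator ::
    "('k::real_normed_field \<Rightarrow> 'a::banach \<Rightarrow> 'a) \<Rightarrow> ('a \<Rightarrow> 'a) \<Rightarrow> bool" where
  "bounded_operator scl S \<longleftrightarrow>
     bounded_linear S \<and> (\<forall>c x. S (scl c x) = scl c (S x))"

lemma bounded_operator_scaleR: "bounded_operator scaleR S \<longleftrightarrow> bounded_linear S"
  by (auto simp: bounded_operator_def bounded_linear.axioms(1) linear_scale bounded_linear.linear)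

text \<open>
  A sequence of operators is a function on \<open>nat\<close> whose value at \<open>0\<close> is never used: all indices
  below are at least \<open>1\<close>.
\<close>

definition submultiplicative :: "(nat \<Rightarrow> 'a::real_normed_vector \<Rightarrow> 'a) \<Rightarrow> bool" where
  "submultiplicative T \<longleftrightarrow>
     (\<exists>C>0. \<forall>z. \<forall>i\<ge>1. \<forall>m\<ge>1. norm (T (i + m) z) \<le> C * norm (T i (T m z)))"

definition almost_commuting :: "(nat \<Rightarrow> 'a::real_normed_vector \<Rightarrow> 'a) \<Rightarrow> bool" where
  "almost_commuting T \<longleftrightarrow>
     (\<forall>x. \<forall>k\<ge>1. (\<lambda>i. T i (T k x) - T k (T i x)) \<longlonglongrightarrow> 0)"

text \<open>
  Lower and upper limits are taken in \<open>ereal\<close>, since the averages may be unbounded.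
\<close>

definition mean_Li_Yorke_pair ::
    "(nat \<Rightarrow> 'a::real_normed_vector \<Rightarrow> 'a) \<Rightarrow> 'a \<Rightarrow> 'a \<Rightarrow> bool" where
  "mean_Li_Yorke_pair T x y \<longleftrightarrow>
     liminf (\<lambda>n. ereal (1 / real n * (\<Sum>i=1..n. norm (T i x - T i y)))) = 0 \<and>
     limsup (\<lambda>n. ereal (1 / real n * (\<Sum>i=1..n. norm (T i x - T i y)))) > 0"

definition mean_Li_Yorke_scrambled ::
    "(nat \<Rightarrow> 'a::real_normed_vector \<Rightarrow> 'a) \<Rightarrow> 'a set \<Rightarrow> bool" where
  "mean_Li_Yorke_scrambled T S \<longleftrightarrow>
     (\<forall>x\<in>S. \<forall>y\<in>S. x \<noteq> y \<longrightarrow> mean_Li_Yorke_pair T x y)"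

definition mean_Li_Yorke_chaotic :: "(nat \<Rightarrow> 'a::real_normed_vector \<Rightarrow> 'a) \<Rightarrow> bool" where
  "mean_Li_Yorke_chaotic T \<longleftrightarrow> (\<exists>S. uncountable S \<and> mean_Li_Yorke_scrambled T S)"

definition (in banach_space) mean_Li_Yorke_chaos_criterion :: "(nat \<Rightarrow> 'a \<Rightarrow> 'a) \<Rightarrow> bool" where
  "mean_Li_Yorke_chaos_criterion T \<longleftrightarrow>
     (\<exists>X0.
        (\<forall>x\<in>X0. liminf (\<lambda>n. ereal (1 / real n * (\<Sum>i=1..n. norm (T i x)))) = 0) \<and>
        (\<exists>(y :: nat \<Rightarrow> 'a) (N :: nat \<Rightarrow> nat).
           \<forall>k\<ge>1. y k \<noteq> 0 \<and> y k \<in> closure (local.span X0) \<and> N k \<ge> 1 \<and>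
             1 / real (N k) * (\<Sum>i=1..N k. norm (T i (y k))) \<ge> real k * norm (y k)))"

end

theory Submission imports Defs begin

text \<open>
  For a mean Li--Yorke pair \<open>(x, y)\<close> put \<open>u = x - y\<close> and let \<open>X\<^sub>0\<close> consist of the \<open>T\<^sub>m u\<close>; almost
  commutativity keeps the lower limit of their averages at \<open>0\<close>. If the averages were bounded by
  \<open>K \<parallel>\<cdot>\<parallel>\<close> on the closed span, then, since some \<open>T\<^sub>m u\<close> is arbitrarily small, submultiplicativity
  would make the averages of \<open>u\<close> tend to \<open>0\<close>. Conversely, if the averages of some \<open>x \<in> X\<^sub>0\<close> do not
  tend to \<open>0\<close>, then the line through \<open>x\<close> is scrambled. Otherwise the averages tend to \<open>0\<close> on the
  whole span of \<open>X\<^sub>0\<close>, and by the Baire category theorem some vector of its closure has averages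
  that are both unbounded and arbitrarily small infinitely often; the line through it is scrambled.
\<close>

section \<open>Orbit averages and real-valued forms of their lower and upper limits\<close>

definition orbit_mean :: "(nat \<Rightarrow> 'a::real_normed_vector \<Rightarrow> 'a) \<Rightarrow> nat \<Rightarrow> 'a \<Rightarrow> real" where
  "orbit_mean T n x = 1 / real n * (\<Sum>i=1..n. norm (T i x))"

lemma orbit_mean_nonneg: "0 \<le> orbit_mean T n x"
  by (simp add: orbit_mean_def sum_nonneg)

lemma sum_norm_eq_orbit_mean: "(\<Sum>i=1..n. norm (T i x)) = real n * orbit_mean T n x"
  by (simp add: orbit_mean_def)

text \<open>Since the values are nonnegative, the lower limit is at least 0, and it is positive
  exactly when some real \<open>e > 0\<close> is eventually a lower bound. This trades
  \<open>ereal\<close> limits for a frequency condition on reals.\<close>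

lemma liminf_ereal_eq_0_iff:
  fixes f :: "nat \<Rightarrow> real"
  assumes "\<And>n. 0 \<le> f n"
  shows "liminf (\<lambda>n. ereal (f n)) = 0 \<longleftrightarrow> (\<forall>e>0. \<exists>\<^sub>F n in sequentially. f n < e)"
proof
  assume L: "liminf (\<lambda>n. ereal (f n)) = 0"
  show "\<forall>e>0. \<exists>\<^sub>F n in sequentially. f n < e"
  proof (intro allI impI, rule ccontr)
    fix e :: real
    assume "e > 0" "\<not> (\<exists>\<^sub>F n in sequentially. f n < e)"
    then have "\<forall>\<^sub>F n in sequentially. ereal e \<le> ereal (f n)"
      by (simp add: frequently_def not_less)
    then have "ereal e \<le> liminf (\<lambda>n. ereal (f n))"
      by (rule Liminf_bounded)
    with L \<open>e > 0\<close> show False by simp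
  qed
next
  assume R: "\<forall>e>0. \<exists>\<^sub>F n in sequentially. f n < e"
  have "0 \<le> liminf (\<lambda>n. ereal (f n))"
    using assms by (intro Liminf_bounded) simp
  moreover have "\<not> 0 < liminf (\<lambda>n. ereal (f n))"
  proof
    assume "0 < liminf (\<lambda>n. ereal (f n))"
    then obtain e where e: "0 < ereal e" "ereal e < liminf (\<lambda>n. ereal (f n))"
      using ereal_dense2 by blast
    then have "\<forall>\<^sub>F n in sequentially. \<not> f n < e"
      by (auto dest!: less_LiminfD elim!: eventually_mono)
    then show False using R e(1) by (simp add: frequently_def)
  qed
  ultimately show "liminf (\<lambda>n. ereal (f n)) = 0" by simp
qed

text \<open>The lower limit lies between 0 and the upper limit, so an upper limit of at most 0
  forces both to be 0, which is convergence.\<close>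

lemma limsup_ereal_pos_iff:
  fixes f :: "nat \<Rightarrow> real"
  assumes "\<And>n. 0 \<le> f n"
  shows "limsup (\<lambda>n. ereal (f n)) > 0 \<longleftrightarrow> \<not> f \<longlonglongrightarrow> 0"
proof -
  have ge: "0 \<le> liminf (\<lambda>n. ereal (f n))"
    using assms by (intro Liminf_bounded) simp
  have le: "liminf (\<lambda>n. ereal (f n)) \<le> limsup (\<lambda>n. ereal (f n))"
    by (simp add: Liminf_le_Limsup)
  have "f \<longlonglongrightarrow> 0 \<longleftrightarrow> (\<lambda>n. ereal (f n)) \<longlonglongrightarrow> 0"
    by (simp add: zero_ereal_def)
  also have "\<dots> \<longleftrightarrow> limsup (\<lambda>n. ereal (f n)) \<le> 0"
    using ge le by (auto simp: tendsto_iff_Liminf_eq_Limsup)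
  finally show ?thesis by auto
qed

text \<open>Linearity turns a condition on two points into one on their difference. It is assumed
  only for \<open>i \<ge> 1\<close>, as \<open>T 0\<close> is arbitrary.\<close>

lemma mean_Li_Yorke_pair_iff:
  assumes "\<And>i. i \<ge> 1 \<Longrightarrow> linear (T i)"
  shows "mean_Li_Yorke_pair T x y \<longleftrightarrow>
    (\<forall>e>0. \<exists>\<^sub>F n in sequentially. orbit_mean T n (x - y) < e) \<and>
    \<not> (\<lambda>n. orbit_mean T n (x - y)) \<longlonglongrightarrow> 0"
proof -
  have "1 / real n * (\<Sum>i=1..n. norm (T i x - T i y)) = orbit_mean T n (x - y)" for n
    unfolding orbit_mean_def using assms
    by (intro arg_cong[where f = "(*) _"] sum.cong) (simp_all add: linear_diff)
  then show ?thesis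
    by (simp add: mean_Li_Yorke_pair_def liminf_ereal_eq_0_iff limsup_ereal_pos_iff
        orbit_mean_nonneg)
qed

section \<open>Orbit averages as continuous seminorms; Cesaro means\<close>

lemma orbit_mean_add:
  assumes "\<And>i. i \<ge> 1 \<Longrightarrow> linear (T i)"
  shows "orbit_mean T n (x + y) \<le> orbit_mean T n x + orbit_mean T n y"
proof -
  have "(\<Sum>i=1..n. norm (T i (x + y))) \<le> (\<Sum>i=1..n. norm (T i x) + norm (T i y))"
    using assms by (intro sum_mono) (simp add: linear_add norm_triangle_ineq)
  then show ?thesis
    by (simp add: orbit_mean_def sum.distrib divide_right_mono flip: add_divide_distrib)
qed

lemma orbit_mean_scaleR:
  assumes "\<And>i. i \<ge> 1 \<Longrightarrow> linear (T i)"
  shows "orbit_mean T n (c *\<^sub>R x) = \<bar>c\<bar> * orbit_mean T n x"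
proof -
  have "(\<Sum>i=1..n. norm (T i (c *\<^sub>R x))) = (\<Sum>i=1..n. \<bar>c\<bar> * norm (T i x))"
    using assms by (intro sum.cong) (simp_all add: linear_scale)
  then show ?thesis by (simp add: orbit_mean_def flip: sum_distrib_left)
qed

lemma orbit_mean_0:
  assumes "\<And>i. i \<ge> 1 \<Longrightarrow> linear (T i)"
  shows "orbit_mean T n 0 = 0"
  using orbit_mean_scaleR[of T n 0 0] assms by simp

lemma continuous_on_orbit_mean:
  assumes "\<And>i. i \<ge> 1 \<Longrightarrow> bounded_linear (T i)"
  shows "continuous_on S (orbit_mean T n)"
  unfolding orbit_mean_def using assms
  by (intro continuous_intros) (simp add: linear_continuous_on)

lemma mean_tendsto_0:
  fixes a :: "nat \<Rightarrow> real"
  assumes "a \<longlonglongrightarrow> 0"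
  shows "(\<lambda>n. 1 / real n * (\<Sum>i=1..n. a i)) \<longlonglongrightarrow> 0"
proof (rule tendstoI)
  fix e :: real
  assume "e > 0"
  then have "\<forall>\<^sub>F n in sequentially. \<bar>a n\<bar> < e / 2"
    using assms by (auto simp: tendsto_iff dist_real_def dest: spec[of _ "e / 2"])
  then obtain N where N: "\<And>i. i \<ge> N \<Longrightarrow> \<bar>a i\<bar> < e / 2"
    by (auto simp: eventually_sequentially)
  define K where "K = (\<Sum>i<N. \<bar>a i\<bar>)"
  have sum_le: "(\<Sum>i=1..n. \<bar>a i\<bar>) \<le> K + real n * (e / 2)" for n
  proof -
    \<comment> \<open>Early terms are kept, late ones are below \<open>e / 2\<close>; granting
      \<open>e / 2\<close> to every index avoids splitting the range. The early terms contribute at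
      most \<open>K\<close>, which disappears after division by \<open>n\<close>.\<close>
    have "(\<Sum>i=1..n. \<bar>a i\<bar>) \<le> (\<Sum>i=1..n. (if i < N then \<bar>a i\<bar> else 0) + e / 2)"
      using N \<open>e > 0\<close> by (intro sum_mono) (auto simp: not_less less_imp_le)
    also have "\<dots> = (\<Sum>i\<in>{1..n} \<inter> {i. i < N}. \<bar>a i\<bar>) + real n * (e / 2)"
      by (simp add: sum.distrib sum.If_cases)
    also have "(\<Sum>i\<in>{1..n} \<inter> {i. i < N}. \<bar>a i\<bar>) \<le> K"
      unfolding K_def by (intro sum_mono2) auto
    finally show ?thesis by simp
  qed
  have "(\<lambda>n. K / real n) \<longlonglongrightarrow> 0"
    by (rule lim_const_over_n)
  then have "\<forall>\<^sub>F n in sequentially. K / real n < e / 2"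
    using \<open>e > 0\<close> by (intro order_tendstoD) auto
  then show "\<forall>\<^sub>F n in sequentially. dist (1 / real n * (\<Sum>i=1..n. a i)) 0 < e"
    using eventually_gt_at_top[of 0]
  proof eventually_elim
    case (elim n)
    have "\<bar>\<Sum>i=1..n. a i\<bar> \<le> K + real n * (e / 2)"
      using sum_abs[of a "{1..n}"] sum_le[of n] by linarith
    also have "\<dots> < real n * e"
      using elim by (simp add: field_simps)
    finally show ?case
      using elim by (simp add: dist_real_def field_simps)
  qed
qed

section \<open>A Baire category argument in the closure of a subspace\<close>

lemma subspace_closure:
  fixes V :: "'a::real_normed_vector set"
  assumes "subspace V"
  shows "subspace (closure V)"
  unfolding subspace_def
proof (intro conjI ballI allI)
  show "0 \<in> closure V"
    using assms closure_subset by (auto dest: subspace_0)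
next
  fix x y assume "x \<in> closure V" "y \<in> closure V"
  then obtain f g where "\<And>n. f n \<in> V" "f \<longlonglongrightarrow> x" "\<And>n. g n \<in> V" "g \<longlonglongrightarrow> y"
    by (auto simp: closure_sequential)
  then have "\<And>n. f n + g n \<in> V" "(\<lambda>n. f n + g n) \<longlonglongrightarrow> x + y"
    using assms by (auto intro: subspace_add tendsto_add)
  then show "x + y \<in> closure V"
    unfolding closure_sequential by (intro exI[of _ "\<lambda>n. f n + g n"]) simp
next
  fix c x assume "x \<in> closure V"
  then obtain f where "\<And>n. f n \<in> V" "f \<longlonglongrightarrow> x"
    by (auto simp: closure_sequential)
  then have "\<And>n. c *\<^sub>R f n \<in> V" "(\<lambda>n. c *\<^sub>R f n) \<longlonglongrightarrow> c *\<^sub>R x"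
    using assms by (auto intro: subspace_scale tendsto_scaleR)
  then show "c *\<^sub>R x \<in> closure V"
    unfolding closure_sequential by (intro exI[of _ "\<lambda>n. c *\<^sub>R f n"]) simp
qed

text \<open>Being small infinitely often and being unbounded are each a countable intersection of
  relatively open dense sets in the complete space \<open>closure V\<close>, so one vector has both
  properties. Density of the first comes from \<open>V\<close>, of the second from
  \<open>unbounded\<close>.\<close>

lemma exists_oscillating_vector:
  fixes p :: "nat \<Rightarrow> 'a::banach \<Rightarrow> real"
  assumes V: "subspace V"
    and cont: "\<And>n. continuous_on UNIV (p n)"
    and add: "\<And>n x y. p n (x + y) \<le> p n x + p n y"
    and scale: "\<And>n c x. p n (c *\<^sub>R x) = \<bar>c\<bar> * p n x"
    and null: "\<And>x. x \<in> V \<Longrightarrow> (\<lambda>n. p n x) \<longlonglongrightarrow> 0"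
    and unbounded: "\<And>K. \<exists>n. \<exists>y\<in>closure V. p n y > K * norm y"
  shows "\<exists>y\<in>closure V. (\<forall>e>0. \<exists>\<^sub>F n in sequentially. p n y < e) \<and> \<not> (\<lambda>n. p n y) \<longlonglongrightarrow> 0"
proof -
  let ?Y = "closure V"
  have Y: "subspace ?Y" using V by (rule subspace_closure)
  \<comment> \<open>Both the threshold and the least admissible index depend on \<open>j\<close>, so
    membership in every \<open>U j\<close> yields arbitrarily small values at arbitrarily late
    indices.\<close>
  define U where "U j = {y \<in> ?Y. \<exists>n\<ge>j. p n y < 1 / Suc j}" for j :: nat
  define W where "W j = {y \<in> ?Y. \<exists>n. p n y > real j}" for j :: nat
  have openU: "openin (top_of_set ?Y) (U j)" for j
  proof -
    have "U j = ?Y \<inter> (\<Union>n\<in>{j..}. {y. p n y < 1 / Suc j})"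
      by (auto simp: U_def)
    moreover have "open (\<Union>n\<in>{j..}. {y. p n y < 1 / Suc j})"
      by (intro open_UN ballI open_Collect_less cont continuous_on_const)
    ultimately show ?thesis by (simp add: openin_open_Int)
  qed
  have openW: "openin (top_of_set ?Y) (W j)" for j
  proof -
    have "W j = ?Y \<inter> (\<Union>n. {y. real j < p n y})"
      by (auto simp: W_def)
    moreover have "open (\<Union>n. {y. real j < p n y})"
      by (intro open_UN ballI open_Collect_less cont continuous_on_const)
    ultimately show ?thesis by (simp add: openin_open_Int)
  qed
  have denseU: "?Y \<subseteq> closure (U j)" for j
  proof (rule closure_mono, rule subsetI)
    fix x assume "x \<in> V"
    then have "\<forall>\<^sub>F n in sequentially. p n x < 1 / Suc j"
      using null by (intro order_tendstoD) auto
    then have "\<forall>\<^sub>F n in sequentially. n \<ge> j \<and> p n x < 1 / Suc j"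
      using eventually_ge_at_top[of j] by eventually_elim simp
    then have "\<exists>n. n \<ge> j \<and> p n x < 1 / Suc j"
      by (rule eventually_happens'[rotated]) simp
    with \<open>x \<in> V\<close> show "x \<in> U j"
      using closure_subset by (auto simp: U_def)
  qed
  have denseW: "?Y \<subseteq> closure (W j)" for j
  proof
    fix y assume y: "y \<in> ?Y"
    show "y \<in> closure (W j)"
      unfolding closure_approachable
    proof (intro allI impI)
      fix r :: real assume "r > 0"
      show "\<exists>w\<in>W j. dist w y < r"
      proof (cases "y \<in> W j")
        case True
        then show ?thesis using \<open>r > 0\<close> by (intro bexI[of _ y]) auto
      next
        case False
        then have py: "p n y \<le> real j" for n
          using y by (auto simp: W_def not_less)
        \<comment> \<open>The point \<open>y\<close> is moved by a multiple of \<open>z\<close> of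
          norm \<open>r / 2\<close>. The factor \<open>4 * real j / r\<close> makes the seminorm of
          this multiple exceed \<open>2 * real j\<close>; as \<open>p n y\<close> is at most
          \<open>real j\<close>, more than \<open>real j\<close> remains at the moved point.\<close>
        obtain n z where z: "z \<in> ?Y" "p n z > (4 * real j / r) * norm z"
          using unbounded by blast
        have "p n 0 = 0" using scale[of n 0 0] by simp
        then have nz: "norm z > 0" using z(2) by auto
        define c where "c = r / (2 * norm z)"
        have c: "c > 0" using nz \<open>r > 0\<close> by (simp add: c_def)
        have "2 * real j = c * ((4 * real j / r) * norm z)"
          using nz \<open>r > 0\<close> by (simp add: c_def field_simps)
        also have "\<dots> < c * p n z"
          using c z(2) by (rule mult_strict_left_mono[rotated])
        finally have "2 * real j < c * p n z" .
        moreover have "c * p n z \<le> p n (y + c *\<^sub>R z) + p n y"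
        proof -
          have "p n (c *\<^sub>R z) \<le> p n (y + c *\<^sub>R z) + p n (- y)"
            using add[of n "y + c *\<^sub>R z" "- y"] by simp
          then show ?thesis using scale[of n c z] scale[of n "-1" y] c by simp
        qed
        ultimately have "p n (y + c *\<^sub>R z) > real j"
          using py[of n] by linarith
        moreover have "y + c *\<^sub>R z \<in> ?Y"
          using Y y z(1) by (simp add: subspace_add subspace_scale)
        moreover have "dist (y + c *\<^sub>R z) y < r"
          using c nz \<open>r > 0\<close> by (simp add: dist_norm c_def field_simps)
        ultimately show ?thesis by (auto simp: W_def)
      qed
    qed
  qed
  have "completely_metrizable_space (top_of_set ?Y)"
    by (simp add: completely_metrizable_space_closedin completely_metrizable_space_euclidean)
  moreover have "openin (top_of_set ?Y) A \<and> top_of_set ?Y closure_of A = topspace (top_of_set ?Y)"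
    if "A \<in> range U \<union> range W" for A
  proof -
    have "openin (top_of_set ?Y) A" using that openU openW by auto
    moreover from openin_subset[OF this] have "A \<subseteq> ?Y" by simp
    moreover have "?Y \<subseteq> closure A"
      using that by (elim UnE rangeE) (simp_all add: denseU denseW)
    ultimately show ?thesis
      by (simp add: closure_of_subtopology Int_absorb1 Int_absorb2)
  qed
  ultimately have "top_of_set ?Y closure_of \<Inter>(range U \<union> range W) = topspace (top_of_set ?Y)"
    by (intro Baire_category) auto
  \<comment> \<open>A dense subset of \<open>?Y\<close> cannot be empty, because \<open>?Y\<close>
    contains 0.\<close>
  then have "\<Inter>(range U \<union> range W) \<noteq> {}"
    using V subspace_0 closure_subset by fastforce
  then obtain y where "y \<in> \<Inter>(range U \<union> range W)" by (auto simp only: ex_in_conv[symmetric])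
  then have yU: "y \<in> U j" and yW: "y \<in> W j" for j by auto
  have "\<exists>\<^sub>F n in sequentially. p n y < e" if "e > 0" for e
    unfolding frequently_sequentially
  proof
    fix N
    obtain k where k: "1 / real (Suc k) < e" using \<open>e > 0\<close> nat_approx_posE by blast
    \<comment> \<open>The index \<open>max N k\<close> secures both \<open>n \<ge> N\<close> and a
      bound below \<open>e\<close>.\<close>
    obtain n where n: "n \<ge> max N k" "p n y < 1 / Suc (max N k)"
      using yU[of "max N k"] by (auto simp: U_def)
    have "1 / real (Suc (max N k)) \<le> 1 / real (Suc k)"
      by (intro divide_left_mono) auto
    with n k show "\<exists>n\<ge>N. p n y < e" by (intro exI[of _ n]) auto
  qed
  moreover have "\<not> (\<lambda>n. p n y) \<longlonglongrightarrow> 0"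
  proof
    assume "(\<lambda>n. p n y) \<longlonglongrightarrow> 0"
    \<comment> \<open>A convergent sequence is bounded, whereas membership in every
      \<open>W j\<close> makes the values unbounded.\<close>
    then have "Bseq (\<lambda>n. p n y)" using convergentI convergent_imp_Bseq by blast
    then obtain K where "\<And>n. \<bar>p n y\<bar> \<le> K" by (auto simp: Bseq_def)
    moreover obtain j :: nat where "K < real j" using reals_Archimedean2 by blast
    moreover obtain n where "p n y > real j" using yW[of j] by (auto simp: W_def)
    ultimately show False by (smt (verit))
  qed
  moreover have "y \<in> ?Y" using yU[of 0] by (simp add: U_def)
  ultimately show ?thesis by blast
qed

section \<open>Scrambled real lines\<close>

lemma mean_Li_Yorke_chaoticI:
  assumes lin: "\<And>i. i \<ge> 1 \<Longrightarrow> linear (T i)"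
    and freq: "\<And>e. e > 0 \<Longrightarrow> \<exists>\<^sub>F n in sequentially. orbit_mean T n u < e"
    and nonnull: "\<not> (\<lambda>n. orbit_mean T n u) \<longlonglongrightarrow> 0"
  shows "mean_Li_Yorke_chaotic T"
proof -
  have "u \<noteq> 0"
  proof
    assume "u = 0"
    with nonnull show False by (simp add: orbit_mean_0[of T, OF lin])
  qed
  then have "inj (\<lambda>r. r *\<^sub>R u)" by (intro injI) simp
  then have "uncountable (range (\<lambda>r. r *\<^sub>R u))"
    using countable_image_inj_on uncountable_UNIV_real by blast
  moreover have "mean_Li_Yorke_pair T (r *\<^sub>R u) (s *\<^sub>R u)" if "r \<noteq> s" for r s
  proof -
    \<comment> \<open>Differences of points on the line are multiples of \<open>u\<close>, and the
      positive factor \<open>\<bar>r - s\<bar>\<close> preserves both conditions.\<close>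
    have eq: "orbit_mean T n (r *\<^sub>R u - s *\<^sub>R u) = \<bar>r - s\<bar> * orbit_mean T n u" for n
      using orbit_mean_scaleR[of T, OF lin] by (simp flip: scaleR_left_diff_distrib)
    have "\<exists>\<^sub>F n in sequentially. \<bar>r - s\<bar> * orbit_mean T n u < e" if "e > 0" for e
      using freq[of "e / \<bar>r - s\<bar>"] \<open>r \<noteq> s\<close> \<open>e > 0\<close> by (simp add: field_simps)
    moreover have "\<not> (\<lambda>n. \<bar>r - s\<bar> * orbit_mean T n u) \<longlonglongrightarrow> 0"
      using nonnull \<open>r \<noteq> s\<close> by (simp add: tendsto_mult_left_iff)
    ultimately show ?thesis
      by (simp add: mean_Li_Yorke_pair_iff[of T, OF lin] eq)
  qed
  ultimately show ?thesis
    unfolding mean_Li_Yorke_chaotic_def mean_Li_Yorke_scrambled_def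
    by (intro exI[of _ "range (\<lambda>r. r *\<^sub>R u)"]) auto
qed

section \<open>Averages of the vectors \<open>T m u\<close>\<close>

lemma frequently_orbit_mean_orbit_less:
  assumes T: "\<And>i. i \<ge> 1 \<Longrightarrow> bounded_linear (T i)"
    and comm: "almost_commuting T"
    and freq: "\<And>e. e > 0 \<Longrightarrow> \<exists>\<^sub>F n in sequentially. orbit_mean T n u < e"
    and "m \<ge> 1" "e > 0"
  shows "\<exists>\<^sub>F n in sequentially. orbit_mean T n (T m u) < e"
proof -
  interpret Tm: bounded_linear "T m" using T \<open>m \<ge> 1\<close> by simp
  obtain B where B: "B > 0" "\<And>x. norm (T m x) \<le> norm x * B"
    using Tm.pos_bounded by blast
  \<comment> \<open>Averaged commutators: almost commutativity makes the terms null, hence also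
    their Cesaro means. What remains of \<open>T i (T m u)\<close> is \<open>T m (T i u)\<close>,
    controlled by the bound \<open>B\<close> of \<open>T m\<close>.\<close>
  define d where "d n = 1 / real n * (\<Sum>i=1..n. norm (T i (T m u) - T m (T i u)))" for n
  have "(\<lambda>i. norm (T i (T m u) - T m (T i u))) \<longlonglongrightarrow> 0"
    using comm \<open>m \<ge> 1\<close> by (auto simp: almost_commuting_def intro: tendsto_norm_zero)
  then have "d \<longlonglongrightarrow> 0" unfolding d_def by (rule mean_tendsto_0)
  then have "\<forall>\<^sub>F n in sequentially. d n < e / 2"
    using \<open>e > 0\<close> by (intro order_tendstoD) auto
  moreover have "\<exists>\<^sub>F n in sequentially. orbit_mean T n u < e / (2 * B)"
    using freq \<open>e > 0\<close> B(1) by simp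
  ultimately have "\<exists>\<^sub>F n in sequentially. orbit_mean T n u < e / (2 * B) \<and> d n < e / 2"
    by (rule frequently_eventually_frequently[rotated])
  then show ?thesis
  proof (rule frequently_elim1)
    fix n assume n: "orbit_mean T n u < e / (2 * B) \<and> d n < e / 2"
    have "(\<Sum>i=1..n. norm (T i (T m u)))
        \<le> (\<Sum>i=1..n. norm (T i u) * B + norm (T i (T m u) - T m (T i u)))"
    proof (rule sum_mono)
      fix i
      show "norm (T i (T m u)) \<le> norm (T i u) * B + norm (T i (T m u) - T m (T i u))"
        using B(2)[of "T i u"] norm_triangle_sub[of "T i (T m u)" "T m (T i u)"] by linarith
    qed
    also have "\<dots> = (\<Sum>i=1..n. norm (T i u)) * B + (\<Sum>i=1..n. norm (T i (T m u) - T m (T i u)))"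
      by (simp add: sum.distrib sum_distrib_right)
    finally have "orbit_mean T n (T m u) \<le> orbit_mean T n u * B + d n"
      unfolding orbit_mean_def d_def
      by (simp add: divide_right_mono flip: add_divide_distrib)
    moreover have "orbit_mean T n u * B < e / 2"
      using n B(1) by (simp add: field_simps)
    ultimately show "orbit_mean T n (T m u) < e" using n by linarith
  qed
qed

lemma exists_orbit_norm_less:
  assumes "\<exists>\<^sub>F n in sequentially. orbit_mean T n u < e"
  shows "\<exists>m\<ge>1. norm (T m u) < e"
proof (rule ccontr)
  assume "\<not> ?thesis"
  then have ge: "e \<le> norm (T m u)" if "m \<ge> 1" for m using that by (auto simp: not_less)
  \<comment> \<open>The index 0 must be avoided: there the average is 0 by the convention for
    division by 0 and says nothing about the orbit.\<close>
  obtain n where n: "n \<ge> 1" "orbit_mean T n u < e"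
    using assms unfolding frequently_sequentially by blast
  have "real n * e \<le> (\<Sum>i=1..n. norm (T i u))"
    using sum_mono[of "{1..n}" "\<lambda>_. e" "\<lambda>i. norm (T i u)"] ge by simp
  then have "real n * e \<le> real n * orbit_mean T n u"
    by (simp only: sum_norm_eq_orbit_mean)
  with n show False by simp
qed

text \<open>By submultiplicativity the orbit of \<open>u\<close> after time \<open>m\<close> is at
  most \<open>C\<close> times the orbit of \<open>T m u\<close>, whose averages are at most
  \<open>K * norm (T m u)\<close>. Some \<open>T m u\<close> is as small as desired, and the first
  \<open>m\<close> terms vanish on averaging.\<close>

lemma orbit_mean_tendsto_0_if_bounded:
  assumes sub: "submultiplicative T"
    and freq: "\<And>e. e > 0 \<Longrightarrow> \<exists>\<^sub>F n in sequentially. orbit_mean T n u < e"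
    and bounded: "\<And>m n. m \<ge> 1 \<Longrightarrow> n \<ge> 1 \<Longrightarrow> orbit_mean T n (T m u) \<le> K * norm (T m u)"
    and K: "K > 0"
  shows "(\<lambda>n. orbit_mean T n u) \<longlonglongrightarrow> 0"
proof (rule tendstoI)
  fix e :: real assume "e > 0"
  obtain C where C: "C > 0"
    "\<And>z i m. i \<ge> 1 \<Longrightarrow> m \<ge> 1 \<Longrightarrow> norm (T (i + m) z) \<le> C * norm (T i (T m z))"
    using sub by (auto simp: submultiplicative_def)
  have "e / (2 * C * K) > 0" using \<open>e > 0\<close> C(1) K by simp
  then obtain m where m: "m \<ge> 1" "norm (T m u) < e / (2 * C * K)"
    using exists_orbit_norm_less[OF freq] by blast
  define L where "L = (\<Sum>i=1..m. norm (T i u))"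
  have "(\<lambda>n. L / real n) \<longlonglongrightarrow> 0" by (rule lim_const_over_n)
  then have "\<forall>\<^sub>F n in sequentially. L / real n < e / 2"
    using \<open>e > 0\<close> by (intro order_tendstoD) auto
  then show "\<forall>\<^sub>F n in sequentially. dist (orbit_mean T n u) 0 < e"
    using eventually_gt_at_top[of m]
  proof eventually_elim
    case (elim n)
    \<comment> \<open>The tail beyond \<open>m\<close> has \<open>k\<close> terms;
      \<open>n > m\<close> gives \<open>k \<ge> 1\<close>, as \<open>bounded\<close> requires. The
      head \<open>L\<close> does not depend on \<open>n\<close>.\<close>
    define k where "k = n - m"
    have k: "k \<ge> 1" "n = k + m" using elim by (auto simp: k_def)
    have "(\<Sum>i=1..n. norm (T i u)) = L + (\<Sum>i=m+1..n. norm (T i u))"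
      unfolding L_def using sum.ub_add_nat[of 1 m "\<lambda>i. norm (T i u)" k] by (simp add: k(2) add.commute)
    also have "(\<Sum>i=m+1..n. norm (T i u)) = (\<Sum>i=1..k. norm (T (i + m) u))"
      using sum.shift_bounds_cl_nat_ivl[of "\<lambda>i. norm (T i u)" 1 m k] by (simp add: k(2) add.commute)
    also have "\<dots> \<le> (\<Sum>i=1..k. C * norm (T i (T m u)))"
      using C(2) m(1) by (intro sum_mono) auto
    also have "\<dots> = C * (real k * orbit_mean T k (T m u))"
      by (simp only: sum_norm_eq_orbit_mean flip: sum_distrib_left)
    also have "\<dots> \<le> C * (real n * (e / (2 * C)))"
    proof (intro mult_left_mono mult_mono)
      have "orbit_mean T k (T m u) \<le> K * norm (T m u)" using bounded m(1) k(1) .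
      also have "\<dots> \<le> e / (2 * C)" using m(2) K C(1) by (simp add: field_simps)
      finally show "orbit_mean T k (T m u) \<le> e / (2 * C)" .
    qed (use C(1) k(2) orbit_mean_nonneg in auto)
    also have "\<dots> = real n * (e / 2)" using C(1) by simp
    finally have "real n * orbit_mean T n u \<le> L + real n * (e / 2)"
      by (simp only: sum_norm_eq_orbit_mean)
    moreover have "L < real n * (e / 2)" using elim by (simp add: field_simps)
    ultimately have "real n * orbit_mean T n u < real n * e" by (simp add: field_simps)
    then show ?case
      using elim orbit_mean_nonneg[of T n u] by (simp add: dist_real_def)
  qed
qed

section \<open>The criterion without sequences, and spans over the ground field\<close>

lemma (in banach_space) mean_Li_Yorke_chaos_criterion_iff:
  "mean_Li_Yorke_chaos_criterion T \<longleftrightarrow>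
    (\<exists>X0. (\<forall>x\<in>X0. \<forall>e>0. \<exists>\<^sub>F n in sequentially. orbit_mean T n x < e) \<and>
      (\<forall>k\<ge>1. \<exists>y\<in>closure (local.span X0). \<exists>n\<ge>1. y \<noteq> 0 \<and> orbit_mean T n y \<ge> real k * norm y))"
proof -
  \<comment> \<open>The conditions for different \<open>k\<close> are independent, so choosing the
    two sequences amounts to a witness for each \<open>k\<close>.\<close>
  have choose: "(\<exists>y N. \<forall>k\<ge>1. P k (y k) (N k)) \<longleftrightarrow> (\<forall>k\<ge>1. \<exists>y n. P k y n)"
    for P :: "nat \<Rightarrow> 'a \<Rightarrow> nat \<Rightarrow> bool"
  proof
    assume "\<forall>k\<ge>1. \<exists>y n. P k y n"
    then have "\<forall>k\<in>{1..}. \<exists>y n. P k y n" by simp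
    then obtain y where "\<forall>k\<in>{1..}. \<exists>n. P k (y k) n" by metis
    then obtain N where "\<forall>k\<in>{1..}. P k (y k) (N k)" by metis
    then show "\<exists>y N. \<forall>k\<ge>1. P k (y k) (N k)" by auto
  qed blast
  have "(\<exists>y N. \<forall>k\<ge>1. y k \<noteq> 0 \<and> y k \<in> closure (local.span X0) \<and> N k \<ge> 1 \<and>
        orbit_mean T (N k) (y k) \<ge> real k * norm (y k)) \<longleftrightarrow>
      (\<forall>k\<ge>1. \<exists>y\<in>closure (local.span X0). \<exists>n\<ge>1. y \<noteq> 0 \<and> orbit_mean T n y \<ge> real k * norm y)"
    for X0
    unfolding choose[of "\<lambda>k y n. y \<noteq> 0 \<and> y \<in> closure (local.span X0) \<and> n \<ge> 1 \<and>
      orbit_mean T n y \<ge> real k * norm y"]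
    by (intro all_cong1 imp_cong refl) blast
  then show ?thesis
    by (simp only: mean_Li_Yorke_chaos_criterion_def orbit_mean_def[symmetric]
        liminf_ereal_eq_0_iff[OF orbit_mean_nonneg])
qed

text \<open>Real scalars act as \<open>scl (of_real r)\<close>. This makes the span over the ground
  field available to the category argument, which works with real subspaces.\<close>

lemma (in banach_space) subspace_real: "local.subspace V \<Longrightarrow> real_vector.subspace V"
  unfolding real_vector.subspace_def
  by (simp add: local.subspace_0 local.subspace_add local.subspace_scale flip: scl_of_real)

text \<open>The averages are homogeneous for all scalars of the ground field, since each
  \<open>T i\<close> with \<open>i \<ge> 1\<close> commutes with \<open>scl\<close>; with
  subadditivity, nullity passes to linear combinations.\<close>

lemma (in banach_space) orbit_mean_tendsto_0_span:
  assumes T: "\<And>i. i \<ge> 1 \<Longrightarrow> bounded_operator scl (T i)"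
    and null: "\<And>x. x \<in> X0 \<Longrightarrow> (\<lambda>n. orbit_mean T n x) \<longlonglongrightarrow> 0"
    and "x \<in> local.span X0"
  shows "(\<lambda>n. orbit_mean T n x) \<longlonglongrightarrow> 0"
  using \<open>x \<in> local.span X0\<close>
proof (induction rule: local.span_induct_alt)
  have lin: "\<And>i. i \<ge> 1 \<Longrightarrow> linear (T i)"
    using T by (simp add: bounded_operator_def bounded_linear.linear)
  case base
  show ?case by (simp add: orbit_mean_0[of T, OF lin])
  case (step c x y)
  have scale: "orbit_mean T n (scl c x) = norm c * orbit_mean T n x" for n
  proof -
    have "(\<Sum>i=1..n. norm (T i (scl c x))) = (\<Sum>i=1..n. norm c * norm (T i x))"
      using T by (intro sum.cong) (simp_all add: bounded_operator_def norm_scl)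
    then show ?thesis by (simp add: orbit_mean_def flip: sum_distrib_left)
  qed
  have "(\<lambda>n. norm c * orbit_mean T n x + orbit_mean T n y) \<longlonglongrightarrow> 0"
    using tendsto_add[OF tendsto_mult_left[OF null[OF step(1)]] step(2), of "norm c"] by simp
  then show ?case
    by (rule tendsto_sandwich[rotated -2, OF tendsto_const])
      (simp_all add: orbit_mean_nonneg orbit_mean_add[of T, OF lin] flip: scale)
qed

section \<open>Passage between scrambled sets and the criterion\<close>

theorem theorem4p11:
  fixes scl :: "'k::real_normed_field \<Rightarrow> 'a::banach \<Rightarrow> 'a"
    and T :: "nat \<Rightarrow> 'a \<Rightarrow> 'a"
  assumes "banach_space scl"
    and "\<And>i. i \<ge> 1 \<Longrightarrow> bounded_operator scl (T i)"
    and "almost_commuting T"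
    and "submultiplicative T"
  shows "mean_Li_Yorke_chaotic T \<longleftrightarrow> banach_space.mean_Li_Yorke_chaos_criterion scl T"
proof -
  interpret banach_space scl by fact
  have bl: "\<And>i. i \<ge> 1 \<Longrightarrow> bounded_linear (T i)"
    using assms(2) by (simp add: bounded_operator_def)
  then have lin: "\<And>i. i \<ge> 1 \<Longrightarrow> linear (T i)"
    by (simp add: bounded_linear.linear)
  show ?thesis
  proof
    assume "mean_Li_Yorke_chaotic T"
    then obtain S where S: "uncountable S" "mean_Li_Yorke_scrambled T S"
      by (auto simp: mean_Li_Yorke_chaotic_def)
    then have "infinite S" using countable_finite by blast
    then obtain x y where "x \<in> S" "y \<in> S" "x \<noteq> y"
      by (metis finite.emptyI finite_insert finite_subset insertI1 singleton_iff subsetI)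
    then have "mean_Li_Yorke_pair T x y"
      using S(2) by (simp add: mean_Li_Yorke_scrambled_def)
    then obtain u where freq: "\<And>e. e > 0 \<Longrightarrow> \<exists>\<^sub>F n in sequentially. orbit_mean T n u < e"
      and nonnull: "\<not> (\<lambda>n. orbit_mean T n u) \<longlonglongrightarrow> 0"
      by (auto simp: mean_Li_Yorke_pair_iff[of T, OF lin])
    define X0 where "X0 = (\<lambda>m. T m u) ` {1..}"
    have "\<exists>y\<in>closure (span X0). \<exists>n\<ge>1. y \<noteq> 0 \<and> orbit_mean T n y \<ge> real k * norm y"
      if "k \<ge> 1" for k :: nat
    proof (rule ccontr)
      \<comment> \<open>Failure for this \<open>k\<close> bounds the averages on the closed span by
        \<open>real k * norm y\<close>, in particular along the orbit of \<open>u\<close>. The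
        criterion speaks of nonzero vectors only, so \<open>T m u = 0\<close> is treated
        separately.\<close>
      assume neg: "\<not> ?thesis"
      have "orbit_mean T n (T m u) \<le> real k * norm (T m u)" if "m \<ge> 1" "n \<ge> 1" for m n
      proof (cases "T m u = 0")
        case True
        then show ?thesis by (simp add: orbit_mean_0[of T, OF lin])
      next
        case False
        have "T m u \<in> closure (span X0)"
          using \<open>m \<ge> 1\<close> closure_subset span_base by (fastforce simp: X0_def)
        with neg False \<open>n \<ge> 1\<close> show ?thesis by force
      qed
      then have "(\<lambda>n. orbit_mean T n u) \<longlonglongrightarrow> 0"
        using \<open>k \<ge> 1\<close> by (intro orbit_mean_tendsto_0_if_bounded[OF assms(4) freq]) auto
      with nonnull show False ..
    qed
    moreover have "\<forall>x\<in>X0. \<forall>e>0. \<exists>\<^sub>F n in sequentially. orbit_mean T n x < e"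
      using frequently_orbit_mean_orbit_less[of T, OF bl assms(3) freq] by (auto simp: X0_def)
    ultimately show "mean_Li_Yorke_chaos_criterion T"
      unfolding mean_Li_Yorke_chaos_criterion_iff by blast
  next
    assume "mean_Li_Yorke_chaos_criterion T"
    then obtain X0
      where freq: "\<And>x e. x \<in> X0 \<Longrightarrow> e > 0 \<Longrightarrow> \<exists>\<^sub>F n in sequentially. orbit_mean T n x < e"
        and large: "\<And>k. k \<ge> 1 \<Longrightarrow>
          \<exists>y\<in>closure (span X0). \<exists>n\<ge>1. y \<noteq> 0 \<and> orbit_mean T n y \<ge> real k * norm y"
      unfolding mean_Li_Yorke_chaos_criterion_iff by blast
    show "mean_Li_Yorke_chaotic T"
    \<comment> \<open>Smallness infinitely often need not survive addition, while convergence to 0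
      does; only in the second case does the whole span consist of null vectors.\<close>
    proof (cases "\<exists>x\<in>X0. \<not> (\<lambda>n. orbit_mean T n x) \<longlonglongrightarrow> 0")
      case True
      then show ?thesis using mean_Li_Yorke_chaoticI[of T, OF lin] freq by blast
    next
      case False
      have "\<exists>n. \<exists>y\<in>closure (span X0). orbit_mean T n y > K * norm y" for K
      proof -
        \<comment> \<open>Exceeding 1 makes \<open>k\<close> admissible in \<open>large\<close>;
          exceeding \<open>K\<close> turns its weak inequality into a strict one for
          \<open>y \<noteq> 0\<close>.\<close>
        obtain k :: nat where k: "max K 1 < real k" using reals_Archimedean2 by blast
        then obtain y n where y: "y \<in> closure (span X0)" "y \<noteq> 0"
          "orbit_mean T n y \<ge> real k * norm y"
          using large[of k] by auto
        moreover have "K * norm y < real k * norm y" using k y(2) by simp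
        ultimately show ?thesis by (meson order_less_le_trans)
      qed
      then obtain y where "\<And>e. e > 0 \<Longrightarrow> \<exists>\<^sub>F n in sequentially. orbit_mean T n y < e"
        "\<not> (\<lambda>n. orbit_mean T n y) \<longlonglongrightarrow> 0"
        using exists_oscillating_vector[of "span X0" "orbit_mean T"]
          subspace_real[OF subspace_span] continuous_on_orbit_mean[of T, OF bl] orbit_mean_add[of T, OF lin]
          orbit_mean_scaleR[of T, OF lin] orbit_mean_tendsto_0_span[of T, OF assms(2)] False by blast
      then show ?thesis using mean_Li_Yorke_chaoticI[of T, OF lin] by blast
    qed
  qed
qed

end
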